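(* Let $\mathcal H$ be a separable Hilbert space with inner product $\langle\cdot,\cdot\rangle$, and let $\mu_{\mathrm{pr}}=N(0,\Gamma_{\mathrm{pr}})$ be a Gaussian prior measure on $\mathcal H$ with zero mean and self-adjoint, positive definite, trace-class covariance $\Gamma_{\mathrm{pr}}$; let $\Gamma_{\mathrm{pr}}^{1/2}$ be its symmetric square root. Let $F:\mathcal H\to\mathbb{R}^m$ be a continuously (Fréchet) differentiable forward model, $y\in\mathbb{R}^m$ data, and $\Gamma_{\mathrm{obs}}=S_{\mathrm{obs}}S_{\mathrm{obs}}^\top$ a symmetric positive definite $m\times m$ noise covariance. Define the whitened model $G(v)=S_{\mathrm{obs}}^{-1}\big(F(\Gamma_{\mathrm{pr}}^{1/2}v)-y\big)$, fix a point $v_{\mathrm{ref}}$ with $u_{\mathrm{ref}}=\Gamma_{\mathrm{pr}}^{1/2}v_{\mathrm{ref}}$, and let $\nabla G(v_{\mathrm{ref}})=S_{\mathrm{obs}}^{-1}\nabla F(u_{\mathrm{ref}})\Gamma_{\mathrm{pr}}^{1/2}=\Psi\Lambda\Phi^\top$ be a rank-$r$ reduced singular value decomposition, with $\Psi\in\mathbb{R}^{m\times r}$ having orthonormal columns, $\Lambda\in\mathbb{R}^{r\times r}$ diagonal with positive entries, and right singular vectors $\phi_1,\dots,\phi_r\in\mathcal H$ orthonormal, $\Phi=[\phi_1,\dots,\phi_r]$. Set $\chi_i=\Gamma_{\mathrm{pr}}^{1/2}\phi_i$, $X=[\chi_1,\dots,\chi_r]$ (so $Xa=\sum_i a_i\chi_i$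 for $a\in\mathbb{R}^r$), define $R:\mathcal H\to\mathbb{R}^r$ by $R_i(u)=\langle \Gamma_{\mathrm{pr}}^{-1/2}u,\Gamma_{\mathrm{pr}}^{-1/2}\chi_i\rangle$ and the projector $Pu=\sum_{i=1}^r\chi_iR_i(u)$. Let $W=\mathrm{span}\{\chi_1,\dots,\chi_r\}$ and $W^\perp=(I-P)\mathcal H$ its complement. Let $\zeta\sim\mu_{\mathrm{pr}}$ and let $u$ be the random variable defined by the system $$(I-P)\zeta=(I-P)u,\qquad P\zeta=X\Big[(\Lambda^2+I)^{-1/2}\big(R(u)+\Lambda\Psi^\top S_{\mathrm{obs}}^{-1}(F(u)-y)\big)\Big],$$ and let $\mu_{\mathrm{RTO}}$ be the law of $u$. Suppose that for all $b\in W^\perp$ the mapping $\mathbb{R}^r\ni a\mapsto a+\Lambda\Psi^\top S_{\mathrm{obs}}^{-1}F(Xa+b)$ is Lipschitz continuous, injective, and has Lipschitz continuous inverse. Then $\mu_{\mathrm{RTO}}$ is equivalent to $\mu_{\mathrm{pr}}$ (mutually absolutely continuous).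
   Context: $\mu_{\mathrm{RTO}}$ is the law of the randomize-then-optimize (RTO) proposal in function space: it modifies a prior draw $\zeta$ only along the finite-dimensional subspace $W$ of the Cameron–Martin space $\Gamma_{\mathrm{pr}}^{1/2}\mathcal H$. Here $\nabla F(u_{\mathrm{ref}})$ is the Fréchet derivative of $F$ at $u_{\mathrm{ref}}$, and $\Lambda,\Psi,\Phi$ come from the reduced SVD of the bounded finite-rank operator $S_{\mathrm{obs}}^{-1}\nabla F(u_{\mathrm{ref}})\Gamma_{\mathrm{pr}}^{1/2}:\mathcal H\to\mathbb{R}^m$. *)

theory Defs
  imports "HOL-Probability.Probability"
begin

definition orthonormal_basis :: "'h::real_inner set \<Rightarrow> bool" where
  "orthonormal_basis B \<longleftrightarrow>
     (\<forall>e\<in>B. norm e = 1) \<and> (\<forall>e\<in>B. \<forall>f\<in>B. e \<noteq> f \<longrightarrow> inner e f = 0) \<and>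
     closure (span B) = UNIV"

(* Trace class for a positive self-adjoint operator C: sum of <C e, e> over an
   orthonormal basis is finite (for positive C, |C| = C). *)
definition pos_trace_class :: "('h::real_inner \<Rightarrow> 'h) \<Rightarrow> bool" where
  "pos_trace_class C \<longleftrightarrow>
     (\<exists>B. orthonormal_basis B \<and> (\<lambda>e. inner e (C e)) summable_on B)"

definition gaussian_measure :: "'h::{real_inner,complete_space,second_countable_topology} measure
     \<Rightarrow> ('h \<Rightarrow> 'h) \<Rightarrow> bool" where
  "gaussian_measure M C \<longleftrightarrow>
     prob_space M \<and> sets M = sets borel \<and>
     (\<forall>h. (inner h (C h) > 0 \<longrightarrow>
            distr M borel (\<lambda>x. inner h x) = density lborel (normal_density 0 (sqrt (inner h (C h))))) \<and>
          (inner h (C h) = 0 \<longrightarrow> distr M borel (\<lambda>x. inner h x) = return borel 0))"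

definition diag_mat :: "real^'n \<Rightarrow> real^'n^'n" where
  "diag_mat d = (\<chi> i j. if i = j then d $ i else 0)"

end

theory Submission
  imports Defs
begin

text \<open>The SVD forces every \<open>\<phi>\<^sub>i\<close> into the range of the square root of the covariance, so \<open>R\<close> consists of
  genuine continuous functionals, which under the prior are standard normal and independent of
  \<open>(I - P) \<zeta>\<close>. Hence the prior null sets are invariant under translations by \<open>W\<close>, and by Fubini
  a Borel set is null iff almost every fibre \<open>{a. (I - P) \<zeta> + X a \<in> A}\<close> is Lebesgue null. The map
  \<open>\<zeta> \<mapsto> u\<close> preserves these fibres, and acts on each of them as a bi-Lipschitz bijection of the
  coefficient space (surjective because the system is solvable for every \<open>\<zeta>\<close>). Such a bijection
  preserves Lebesgue null sets in both directions.\<close>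

section \<open>The Riesz representation theorem\<close>

text \<open>The representing vector is the minimiser of the quadratic functional
  \<open>J x = (norm x)\<^sup>2 - 2 * f x\<close>. Completeness provides the minimiser as the limit
  of a minimising sequence, and vanishing of the first variation there identifies \<open>f\<close>
  with \<open>inner w\<close>.\<close>

lemma riesz_representation:
  fixes f :: "'h::{real_inner,complete_space} \<Rightarrow> real"
  assumes "bounded_linear f"
  obtains w where "\<And>x. f x = inner w x"
proof -
  interpret f: bounded_linear f by fact
  define J where "J x = (norm x)\<^sup>2 - 2 * f x" for x
  obtain K where K: "\<And>x. norm (f x) \<le> norm x * K"
    using f.bounded by blast
  have J_lower: "- K\<^sup>2 \<le> J x" for x
  proof -
    have "f x \<le> norm x * K" using K[of x] by auto
    moreover have "0 \<le> (norm x - K)\<^sup>2" by simp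
    ultimately show ?thesis by (simp add: J_def power2_diff)
  qed
  then have bdd: "bdd_below (range J)" by (auto intro!: bdd_belowI)
  define I where "I = Inf (range J)"
  have I_le: "I \<le> J x" for x
    unfolding I_def by (rule cInf_lower[OF _ bdd]) simp
  have "\<exists>x. J x < I + inverse (real (Suc n))" for n
    using cInf_lessD[of "range J" "I + inverse (real (Suc n))"] by (auto simp: I_def)
  then obtain u where u: "\<And>n. J (u n) < I + inverse (real (Suc n))" by metis
  have parallelogram: "(norm (x - z))\<^sup>2 \<le> 2 * J x + 2 * J z - 4 * I" for x z
  proof -
    \<comment> \<open>The linear terms cancel, so this is the parallelogram law. The midpoint has
      value at least \<open>I\<close>, hence two near-minimisers are close to each other.\<close>
    have "2 * J x + 2 * J z = 4 * J ((1/2) *\<^sub>R (x + z)) + (norm (x - z))\<^sup>2"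
      by (simp add: J_def f.scaleR f.add power2_norm_eq_inner inner_simps inner_commute algebra_simps)
    then show ?thesis using I_le[of "(1/2) *\<^sub>R (x + z)"] by linarith
  qed
  have "Cauchy u"
  proof (rule metric_CauchyI)
    fix e :: real assume "0 < e"
    then obtain N where N: "inverse (real (Suc N)) < e\<^sup>2 / 4"
      using reals_Archimedean[of "e\<^sup>2 / 4"] by auto
    have "dist (u m) (u n) < e" if "N \<le> m" "N \<le> n" for m n
    proof -
      have "inverse (real (Suc m)) \<le> inverse (real (Suc N))" "inverse (real (Suc n)) \<le> inverse (real (Suc N))"
        using that by (simp_all add: field_simps)
      then have "(norm (u m - u n))\<^sup>2 < e\<^sup>2"
        using parallelogram[of "u m" "u n"] u[of m] u[of n] N by linarith
      then show ?thesis
        using \<open>0 < e\<close> by (simp add: dist_norm power2_less_imp_less)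
    qed
    then show "\<exists>M. \<forall>m\<ge>M. \<forall>n\<ge>M. dist (u m) (u n) < e" by blast
  qed
  then obtain w where w: "u \<longlonglongrightarrow> w"
    using Cauchy_convergent_iff convergent_def by blast
  have "(\<lambda>n. J (u n)) \<longlonglongrightarrow> J w"
    unfolding J_def by (intro tendsto_intros f.tendsto w)
  moreover have "(\<lambda>n. I + inverse (real (Suc n))) \<longlonglongrightarrow> I"
    using LIMSEQ_inverse_real_of_nat_add by simp
  ultimately have "J w \<le> I"
    by (rule LIMSEQ_le) (use u less_imp_le in blast)
  then have min: "J w \<le> J x" for x using I_le[of x] by linarith
  have "f x = inner w x" for x
  proof (cases "x = 0")
    case False
    \<comment> \<open>This \<open>t\<close> minimises the quadratic polynomial that \<open>J\<close>
      is along the line through \<open>w\<close> in direction \<open>x\<close>; the resulting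
      decrease must be zero.\<close>
    define t where "t = (f x - inner w x) / inner x x"
    have "J (w + t *\<^sub>R x) = J w - 2 * t * (f x - inner w x) + (t * t) * inner x x"
      by (simp add: J_def f.scaleR f.add power2_norm_eq_inner inner_simps inner_commute algebra_simps)
    also have "\<dots> = J w - (f x - inner w x)\<^sup>2 / inner x x"
      using False by (simp add: t_def field_simps power2_eq_square)
    finally have "(f x - inner w x)\<^sup>2 / inner x x \<le> 0"
      using min[of "w + t *\<^sub>R x"] by linarith
    then show ?thesis
      using False inner_gt_zero_iff[of x] by (auto simp: divide_le_0_iff simp del: inner_gt_zero_iff)
  qed (simp add: f.zero)
  then show ?thesis by (rule that)
qed

section \<open>Uniqueness of characteristic functions in Hilbert space\<close>

text \<open>The value at 0 of the characteristic function is the total mass. Both measures can thus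
  be normalised by the same constant \<open>c\<close> and compared by Levy uniqueness; for
  \<open>c = 0\<close> both vanish.\<close>

lemma finite_measure_eqI_char:
  fixes M N :: "real measure"
  assumes "finite_measure M" "finite_measure N"
    and [measurable_cong, simp]: "sets M = sets borel" "sets N = sets borel"
    and char_eq: "char M = char N"
  shows "M = N"
proof -
  interpret M: finite_measure M by fact
  interpret N: finite_measure N by fact
  have [simp]: "space M = UNIV" "space N = UNIV"
    using sets_eq_imp_space_eq[OF assms(3)] sets_eq_imp_space_eq[OF assms(4)] by simp_all
  define c where "c = measure M UNIV"
  have cN: "measure N UNIV = c"
    using fun_cong[OF char_eq, of 0] by (simp add: char_def c_def)
  show ?thesis
  proof (cases "c = 0")
    case True
    then have "emeasure M UNIV = 0" "emeasure N UNIV = 0"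
      using cN by (simp_all add: c_def M.emeasure_eq_measure N.emeasure_eq_measure)
    then have "emeasure M A = 0" "emeasure N A = 0" for A
      using emeasure_space[of M A] emeasure_space[of N A] by simp_all
    then show ?thesis by (intro measure_eqI) simp_all
  next
    case False
    then have c: "0 < c" by (simp add: c_def zero_less_measure_iff)
    define D where "D L = density L (\<lambda>_. ennreal (1 / c))" for L :: "real measure"
    have D: "real_distribution (D L) \<and> char (D L) = (\<lambda>t. complex_of_real (1 / c) * char L t)"
      if "finite_measure L" and [simp, measurable_cong]: "sets L = sets borel"
        and L: "measure L UNIV = c" for L
    proof -
      interpret L: finite_measure L by fact
      have [simp]: "space L = UNIV" using sets_eq_imp_space_eq[OF that(2)] by simp
      have "emeasure (D L) UNIV = 1"
        using c L by (simp add: D_def emeasure_density_const L.emeasure_eq_measure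
            ennreal_mult'[symmetric])
      then have "prob_space (D L)" by (intro prob_spaceI) (simp add: D_def)
      moreover have "char (D L) t = complex_of_real (1 / c) * char L t" for t
        using c by (simp add: char_def D_def integral_density scaleR_conv_of_real)
      ultimately show ?thesis
        by (auto simp: real_distribution_def real_distribution_axioms_def D_def)
    qed
    have "D M = D N"
      using D[OF assms(1,3)] D[OF assms(2,4) cN] char_eq
      by (intro Levy_uniqueness) (auto simp: c_def)
    show ?thesis
    proof (rule measure_eqI)
      fix A assume A: "A \<in> sets M"
      have "emeasure (D M) A = emeasure (D N) A" by (simp add: \<open>D M = D N\<close>)
      then show "emeasure M A = emeasure N A"
        using A c by (simp add: D_def emeasure_density_const ennreal_mult_cancel_left)
    qed simp
  qed
qed

section \<open>Cylinder sets and the Borel sigma-algebra\<close>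

inductive_set cylinder_sets :: "'h::real_inner set set" where
  UNIV: "UNIV \<in> cylinder_sets"
| Int_halfspace: "C \<in> cylinder_sets \<Longrightarrow> (B :: real set) \<in> sets borel \<Longrightarrow>
    C \<inter> {x. inner h x \<in> B} \<in> cylinder_sets"

lemma Int_cylinder_sets: "C \<in> cylinder_sets \<Longrightarrow> D \<in> cylinder_sets \<Longrightarrow> C \<inter> D \<in> cylinder_sets"
proof (induction rule: cylinder_sets.induct)
  case (Int_halfspace C B h)
  then have "(C \<inter> D) \<inter> {x. inner h x \<in> B} \<in> cylinder_sets"
    by (intro cylinder_sets.intros) auto
  then show ?case by (simp add: Int_ac)
qed simp

lemma cylinder_sets_borel:
  fixes C :: "'h::{real_inner,second_countable_topology} set"
  assumes "C \<in> cylinder_sets" shows "C \<in> sets borel"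
  using assms by induction auto

text \<open>Separability is used twice: a closed ball is the intersection of half-spaces over a
  countable dense set \<open>D\<close> of normal directions, and an open set is a countable union of
  closed balls with centres in \<open>D\<close> and rational radii.\<close>

lemma sigma_sets_cylinder_sets:
  "sigma_sets UNIV (cylinder_sets :: 'h::{real_inner,second_countable_topology} set set) = sets borel"
proof
  show "sigma_sets UNIV cylinder_sets \<subseteq> sets (borel :: 'h measure)"
    using sets.sigma_sets_subset[of cylinder_sets "borel :: 'h measure"] cylinder_sets_borel by auto
next
  interpret S: sigma_algebra UNIV "sigma_sets UNIV (cylinder_sets :: 'h set set)"
    by (rule sigma_algebra_sigma_sets) simp
  obtain D :: "'h set" where D: "countable D" "\<And>U. open U \<Longrightarrow> U \<noteq> {} \<Longrightarrow> \<exists>d\<in>D. d \<in> U"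
    by (rule countable_dense_setE) blast
  have Dne: "D \<noteq> {}" using D(2)[of UNIV] by auto
  have cball_eq: "cball a r = (\<Inter>d\<in>D. {x. inner d x \<in> {..inner d a + r * norm d}})"
    if "0 \<le> r" for a :: 'h and r
  proof (intro set_eqI iffI)
    fix x assume "x \<in> cball a r"
    then have "norm (x - a) \<le> r" by (simp add: dist_norm norm_minus_commute)
    then have "inner d (x - a) \<le> r * norm d" for d
      using norm_cauchy_schwarz[of d "x - a"] mult_left_mono[of "norm (x - a)" r "norm d"]
      by (simp add: mult.commute)
    then show "x \<in> (\<Inter>d\<in>D. {x. inner d x \<in> {..inner d a + r * norm d}})"
      by (simp add: inner_diff_right algebra_simps)
  next
    fix x assume x: "x \<in> (\<Inter>d\<in>D. {x. inner d x \<in> {..inner d a + r * norm d}})"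
    \<comment> \<open>The directions whose inequality fails form an open set, so if there were any,
      one would lie in \<open>D\<close>. Hence the inequality holds in every direction, in
      particular for \<open>d = x - a\<close>, which bounds the norm.\<close>
    define U where "U = {d. inner d (x - a) > r * norm d}"
    have "open U" unfolding U_def by (intro open_Collect_less continuous_intros)
    moreover have "U \<inter> D = {}" using x by (auto simp: U_def inner_diff_right algebra_simps)
    ultimately have "U = {}" using D(2)[of U] by blast
    then have "x - a \<notin> U" by simp
    then have "norm (x - a) * norm (x - a) \<le> r * norm (x - a)"
      by (simp add: U_def not_less flip: power2_norm_eq_inner power2_eq_square)
    then show "x \<in> cball a r"
      using that by (cases "x = a") (auto simp: dist_norm norm_minus_commute)
  qed
  have halfspace: "{x. inner d x \<in> B} \<in> sigma_sets UNIV cylinder_sets"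
    if "B \<in> sets borel" for d :: 'h and B
    using cylinder_sets.Int_halfspace[OF cylinder_sets.UNIV that, of d] by auto
  have cball: "cball a r \<in> sigma_sets UNIV cylinder_sets" if "0 \<le> r" for a :: 'h and r
    unfolding cball_eq[OF that]
    by (rule S.countable_INT'[OF D(1) Dne]) (auto intro!: halfspace simp del: atMost_iff)
  have "U \<in> sigma_sets UNIV cylinder_sets" if "open U" for U :: "'h set"
  proof -
    define J where "J = {(a, q). a \<in> D \<and> q \<in> \<rat> \<and> 0 \<le> q \<and> cball a q \<subseteq> U}"
    have "countable J"
      by (rule countable_subset[of _ "D \<times> \<rat>"]) (auto simp: J_def D(1) countable_rat)
    have "U \<subseteq> (\<Union>(a, q)\<in>J. cball a q)"
    proof
      fix x assume "x \<in> U"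
      then obtain e where e: "0 < e" "ball x e \<subseteq> U" using \<open>open U\<close> openE by blast
      obtain a where a: "a \<in> D" "a \<in> ball x (e / 2)" using D(2)[of "ball x (e / 2)"] e by auto
      obtain q where q: "q \<in> \<rat>" "dist x a < q" "q < e / 2"
        using Rats_dense_in_real[of "dist x a" "e / 2"] a by auto
      have "cball a q \<subseteq> ball x e"
      proof
        fix z assume "z \<in> cball a q"
        then show "z \<in> ball x e" using dist_triangle[of x z a] q a by simp
      qed
      moreover have "0 \<le> q" using q(2) zero_le_dist[of x a] by linarith
      ultimately have "(a, q) \<in> J" using a q e by (auto simp: J_def)
      moreover have "x \<in> cball a q" using q by (simp add: dist_commute)
      ultimately show "x \<in> (\<Union>(a, q)\<in>J. cball a q)" by blast
    qed
    then have "U = (\<Union>(a, q)\<in>J. cball a q)" by (auto simp: J_def)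
    then show ?thesis
      using S.countable_UN''[OF \<open>countable J\<close>, of "\<lambda>(a, q). cball a q"] cball
      by (auto simp: J_def)
  qed
  then show "sets borel \<subseteq> sigma_sets UNIV (cylinder_sets :: 'h set set)"
    unfolding borel_def using S.sigma_sets_subset[of "Collect open"] by auto
qed

text \<open>The Fourier transform of \<open>M\<close> restricted to \<open>C\<close>. At
  \<open>h = 0\<close> it gives the mass of \<open>C\<close>; keeping all frequencies makes the
  claim strong enough for an induction that adds one constraint to \<open>C\<close> at a
  time.\<close>

definition fourier_on :: "'h::real_inner measure \<Rightarrow> 'h set \<Rightarrow> 'h \<Rightarrow> complex" where
  "fourier_on M C h = (\<integral>x. indicator C x *\<^sub>R iexp (inner h x) \<partial>M)"

lemma integrable_bounded_iexp:
  fixes w :: "'h::{real_inner,second_countable_topology} \<Rightarrow> real"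
  assumes "finite_measure M" and [measurable_cong]: "sets M = sets borel"
    and [measurable]: "w \<in> borel_measurable borel" and w: "\<And>x. \<bar>w x\<bar> \<le> K"
  shows "integrable M (\<lambda>x. w x *\<^sub>R iexp (inner h x))"
proof -
  interpret finite_measure M by fact
  show ?thesis
    by (rule integrable_const_bound[where B=K]) (use w in auto)
qed

text \<open>By Euler's formula the cosine is a sum of two exponentials, which only shift the
  frequency \<open>h\<close> by \<open>k\<close> and \<open>- k\<close>. The modulated integral is
  therefore determined by the restricted Fourier transform.\<close>

lemma fourier_on_modulated:
  fixes M :: "'h::{real_inner,second_countable_topology} measure"
  assumes "finite_measure M" and [measurable_cong]: "sets M = sets borel"
    and [measurable]: "C \<in> sets borel"
  shows "(\<integral>x. (indicator C x * (1 + cos (inner k x + \<theta>))) *\<^sub>R iexp (inner h x) \<partial>M)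
     = fourier_on M C h + (cis \<theta> * fourier_on M C (h + k) + cis (- \<theta>) * fourier_on M C (h - k)) / 2"
proof -
  have "(indicator C x * (1 + cos (inner k x + \<theta>))) *\<^sub>R iexp (inner h x)
    = indicator C x *\<^sub>R iexp (inner h x)
      + (cis \<theta> * (indicator C x *\<^sub>R iexp (inner (h + k) x))
      + cis (- \<theta>) * (indicator C x *\<^sub>R iexp (inner (h - k) x))) / 2" for x
  proof -
    have "complex_of_real (cos (inner k x + \<theta>))
        = (cis \<theta> * iexp (inner k x) + cis (- \<theta>) * iexp (- inner k x)) / 2"
      by (simp add: cis_conv_exp cos_of_real[symmetric] cos_exp_eq exp_add[symmetric] algebra_simps)
    moreover have "iexp (inner (h + k) x) = iexp (inner h x) * iexp (inner k x)"
      "iexp (inner (h - k) x) = iexp (inner h x) * iexp (- inner k x)"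
      by (simp_all add: inner_simps exp_add[symmetric] algebra_simps)
    ultimately show ?thesis
      by (simp add: scaleR_conv_of_real indicator_def algebra_simps add_divide_distrib)
  qed
  moreover have "integrable M (\<lambda>x. indicator C x *\<^sub>R iexp (inner h x))" for h
    by (rule integrable_bounded_iexp[where K=1]) (use assms in \<open>auto simp: indicator_def\<close>)
  ultimately show ?thesis by (simp add: fourier_on_def del: mult_scaleR_right)
qed

text \<open>The constraint on \<open>inner h x\<close> is handled on the real line: a weighted copy
  of each measure is pushed forward by \<open>inner h\<close>, and its characteristic function
  involves only \<open>fourier_on\<close> of \<open>C\<close>. One-dimensional uniqueness then
  equates the weighted masses of the smaller set.\<close>

lemma fourier_on_Int_halfspace:
  fixes M N :: "'h::{real_inner,second_countable_topology} measure"
  assumes M: "finite_measure M" "sets M = sets borel"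
    and N: "finite_measure N" "sets N = sets borel"
    and C: "C \<in> sets borel" and eq: "\<And>h. fourier_on M C h = fourier_on N C h"
    and B[measurable]: "B \<in> sets borel"
  shows "fourier_on M (C \<inter> {x. inner h x \<in> B}) k = fourier_on N (C \<inter> {x. inner h x \<in> B}) k"
proof -
  define D where "D = C \<inter> {x. inner h x \<in> B}"
  have [measurable]: "C \<in> sets borel" by fact
  have [measurable]: "D \<in> sets borel" unfolding D_def by measurable
  \<comment> \<open>Adding 1 to the cosine makes \<open>w k \<theta>\<close> the density of a positive measure, whose image under
    \<open>inner h\<close> is accessible to one-dimensional uniqueness; the 1 is subtracted again at the end.\<close>
  define w where "w k \<theta> x = indicator C x * (1 + cos (inner k x + \<theta>))" for k \<theta> and x :: 'h
  have w_meas[measurable]: "w k \<theta> \<in> borel_measurable borel" for k \<theta>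
    unfolding w_def by measurable
  have w_nonneg: "0 \<le> w k \<theta> x" for k \<theta> x
    using cos_ge_minus_one[of "inner k x + \<theta>"] by (auto simp: w_def indicator_def simp del: cos_ge_minus_one)
  have w_le: "w k \<theta> x \<le> 2" for k \<theta> x
    using cos_le_one[of "inner k x + \<theta>"] by (simp add: w_def indicator_def)
  define K where "K L k \<theta> = distr (density L (w k \<theta>)) borel (inner h)" for L k \<theta>
  have K: "finite_measure (K L k \<theta>)"
      "char (K L k \<theta>) s = fourier_on L C (s *\<^sub>R h) + (cis \<theta> * fourier_on L C (s *\<^sub>R h + k)
        + cis (- \<theta>) * fourier_on L C (s *\<^sub>R h - k)) / 2"
      "measure (K L k \<theta>) B = (\<integral>x. indicator D x * (1 + cos (inner k x + \<theta>)) \<partial>L)"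
    if L: "finite_measure L" and [measurable_cong]: "sets L = sets borel" for L k \<theta> s
  proof -
    interpret L: finite_measure L by fact
    have spL[simp]: "space L = UNIV" using sets_eq_imp_space_eq[OF that(2)] by simp
    have int: "integrable L (w k \<theta>)"
      by (rule L.integrable_const_bound[where B=2]) 
        (use w_nonneg w_le in \<open>auto simp: abs_le_iff intro: order_trans[of _ 0]\<close>)
    interpret D: finite_measure "density L (w k \<theta>)"
      using int w_nonneg by (intro finite_measureI)
        (simp add: emeasure_density nn_integral_eq_integral)
    show "finite_measure (K L k \<theta>)"
      unfolding K_def by (rule D.finite_measure_distr) measurable
    have "char (K L k \<theta>) s = (\<integral>x. w k \<theta> x *\<^sub>R iexp (inner (s *\<^sub>R h) x) \<partial>L)"
      by (simp add: char_def K_def integral_distr integral_density w_nonneg)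
    then show "char (K L k \<theta>) s = fourier_on L C (s *\<^sub>R h) + (cis \<theta> * fourier_on L C (s *\<^sub>R h + k)
        + cis (- \<theta>) * fourier_on L C (s *\<^sub>R h - k)) / 2"
      using fourier_on_modulated[OF L that(2) C, of k \<theta> "s *\<^sub>R h"]
      unfolding w_def by (rule trans)
    have "measure (K L k \<theta>) B = (\<integral>y. indicator B y \<partial>K L k \<theta>)" by (simp add: K_def)
    also have "\<dots> = (\<integral>x. w k \<theta> x *\<^sub>R indicator B (inner h x) \<partial>L)"
      unfolding K_def by (subst integral_distr) (auto simp: integral_density w_nonneg)
    also have "\<dots> = (\<integral>x. indicator D x * (1 + cos (inner k x + \<theta>)) \<partial>L)"
      by (intro Bochner_Integration.integral_cong) (auto simp: w_def D_def indicator_def)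
    finally show "measure (K L k \<theta>) B = (\<integral>x. indicator D x * (1 + cos (inner k x + \<theta>)) \<partial>L)" .
  qed
  have "K M k \<theta> = K N k \<theta>" for k \<theta>
    by (rule finite_measure_eqI_char) (use K M N eq in \<open>auto simp: K_def\<close>)
  then have meq: "(\<integral>x. indicator D x * (1 + cos (inner k x + \<theta>)) \<partial>M)
    = (\<integral>x. indicator D x * (1 + cos (inner k x + \<theta>)) \<partial>N)" for k \<theta>
    using K(3)[OF M] K(3)[OF N] by metis
  \<comment> \<open>With zero frequency and zero phase the weight is 2 on \<open>D\<close>, so half
    of that integral is the mass of \<open>D\<close>.\<close>
  have split: "(\<integral>x. indicator D x * cos (inner k x + \<theta>) \<partial>L)
      = (\<integral>x. indicator D x * (1 + cos (inner k x + \<theta>)) \<partial>L)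
        - (\<integral>x. indicator D x * (1 + cos (inner 0 x + 0)) \<partial>L) / 2"
    if L: "finite_measure L" and [measurable_cong]: "sets L = sets borel" for L \<theta>
  proof -
    interpret L: finite_measure L by fact
    have "integrable L (\<lambda>x. indicator D x * cos (inner k x + \<theta>) :: real)"
      by (rule L.integrable_const_bound[where B=1]) (auto simp: indicator_def)
    moreover have "integrable L (\<lambda>x. indicator D x :: real)"
      by (rule L.integrable_const_bound[where B=1]) (auto simp: indicator_def)
    ultimately     show ?thesis by (simp add: distrib_left)
  qed
  \<comment> \<open>Phase 0 yields the real part; phase \<open>- pi / 2\<close> turns the cosine
    into the sine of the imaginary part.\<close>
  have four: "fourier_on L D k = Complex (\<integral>x. indicator D x * cos (inner k x + 0) \<partial>L)
      (\<integral>x. indicator D x * cos (inner k x + (- pi / 2)) \<partial>L)"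
    if L: "finite_measure L" and [measurable_cong]: "sets L = sets borel" for L
  proof -
    interpret L: finite_measure L by fact
    have i: "integrable L (\<lambda>x. indicator D x *\<^sub>R iexp (inner k x))"
      by (rule integrable_bounded_iexp[where K=1]) (use that in \<open>auto simp: indicator_def\<close>)
    have "sin t = cos (t + (- pi / 2))" for t :: real by (simp add: cos_diff)
    then show ?thesis
      using integral_Re[OF i] integral_Im[OF i]
      by (simp add: fourier_on_def complex_eq_iff Re_exp Im_exp)
  qed
  show ?thesis
    unfolding D_def[symmetric] four[OF M] four[OF N] split[OF M] split[OF N] meq ..
qed

theorem finite_measure_eqI_fourier:
  fixes M N :: "'h::{real_inner,second_countable_topology} measure"
  assumes M: "finite_measure M" "sets M = sets borel"
    and N: "finite_measure N" "sets N = sets borel"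
    and eq: "\<And>h. (\<integral>x. iexp (inner h x) \<partial>M) = (\<integral>x. iexp (inner h x) \<partial>N)"
  shows "M = N"
proof -
  interpret M: finite_measure M by fact
  interpret N: finite_measure N by fact
  have cyl: "fourier_on M C h = fourier_on N C h" if "C \<in> cylinder_sets" for C h
    using that
  proof (induction arbitrary: h)
    case UNIV
    then show ?case using eq by (simp add: fourier_on_def)
  next
    case (Int_halfspace C B h')
    then show ?case
      by (intro fourier_on_Int_halfspace[OF M N cylinder_sets_borel]) auto
  qed
  have "emeasure M C = emeasure N C" if "C \<in> cylinder_sets" for C
  proof -
    have "complex_of_real (measure M C) = complex_of_real (measure N C)"
      using cyl[OF that, of 0] cylinder_sets_borel[OF that] M(2) N(2)
      by (simp add: fourier_on_def scaleR_conv_of_real sets_eq_imp_space_eq[OF M(2)]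
          sets_eq_imp_space_eq[OF N(2)])
    then show ?thesis by (simp add: M.emeasure_eq_measure N.emeasure_eq_measure)
  qed
  then show ?thesis
    by (intro measure_eqI_generator_eq[where E=cylinder_sets and \<Omega>=UNIV and A="\<lambda>_. UNIV"])
      (auto simp: Int_stable_def Int_cylinder_sets sigma_sets_cylinder_sets M(2) N(2)
        cylinder_sets.UNIV)
qed

section \<open>Null sets of Gaussian measures along Cameron--Martin directions\<close>

text \<open>The transform at \<open>h\<close> depends only on the marginal along \<open>h\<close>: a
  point mass at 0, or a normal law, for which it is the standard normal characteristic function at
  the standard deviation.\<close>

lemma gaussian_measure_fourier:
  assumes "gaussian_measure M C" "0 \<le> inner h (C h)"
  shows "(\<integral>x. iexp (inner h x) \<partial>M) = complex_of_real (exp (- (inner h (C h)) / 2))"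
proof -
  from assms(1) have "prob_space M" and [measurable_cong]: "sets M = sets borel"
    by (simp_all add: gaussian_measure_def)
  interpret prob_space M by fact
  show ?thesis
  proof (cases "inner h (C h) = 0")
    case True
    then have "distr M borel (inner h) = return borel 0"
      using assms(1) by (simp add: gaussian_measure_def)
    then have "(\<integral>y. iexp y \<partial>distr M borel (inner h)) = iexp 0"
      by (simp add: integral_return)
    then show ?thesis using True by (simp add: integral_distr)
  next
    case False
    define \<sigma> where "\<sigma> = sqrt (inner h (C h))"
    have pos: "0 < \<sigma>" and \<sigma>2: "\<sigma>\<^sup>2 = inner h (C h)"
      using False assms(2) by (simp_all add: \<sigma>_def)
    have "distributed M lborel (inner h) (normal_density 0 \<sigma>)"
      using assms False by (simp add: distributed_def gaussian_measure_def \<sigma>_def cong: distr_cong)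
    then have "distributed M lborel (\<lambda>x. inner h x / \<sigma>) std_normal_density"
      using normal_standard_normal_convert[OF pos, of "inner h" 0] by simp
    then have std: "distr M borel (\<lambda>x. inner h x / \<sigma>) = std_normal_distribution"
      by (simp add: distributed_def cong: distr_cong)
    have "(\<integral>x. iexp (inner h x) \<partial>M) = char (distr M borel (\<lambda>x. inner h x / \<sigma>)) \<sigma>"
      using pos by (simp add: char_def integral_distr)
    also have "\<dots> = complex_of_real (exp (- (inner h (C h)) / 2))"
      unfolding std char_std_normal_distribution \<sigma>2 ..
    finally show ?thesis .
  qed
qed

text \<open>Along the Cameron--Martin direction \<open>C k\<close> the coordinate \<open>inner k\<close> is standard normal
  and independent of the remainder, so resampling it does not change the law.\<close>
lemma gaussian_measure_resample:
  fixes C :: "'h::{real_inner,complete_space,second_countable_topology} \<Rightarrow> 'h"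
  assumes gauss: "gaussian_measure M C"
    and lin: "bounded_linear C"
    and sa: "\<And>x z. inner (C x) z = inner x (C z)"
    and nonneg: "\<And>x. 0 \<le> inner x (C x)"
    and k: "inner k (C k) = 1"
  shows "M = distr (M \<Otimes>\<^sub>M std_normal_distribution) borel
    (\<lambda>(x, s). x - inner k x *\<^sub>R C k + s *\<^sub>R C k)"
    (is "M = distr ?P borel ?f")
proof -
  interpret C: bounded_linear C by fact
  from gauss have "prob_space M" and setsM[measurable_cong]: "sets M = sets borel"
    by (simp_all add: gaussian_measure_def)
  interpret prob_space M by fact
  interpret N: prob_space std_normal_distribution
    by (rule prob_space_normal_density) simp
  interpret PP: pair_prob_space M std_normal_distribution ..
  have [measurable]: "?f \<in> borel_measurable ?P" by measurable
  show ?thesis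
  proof (rule finite_measure_eqI_fourier)
    fix h
    \<comment> \<open>Chosen so that
      \<open>inner h (x - inner k x *\<^sub>R C k) = inner h' x\<close>. Passing from
      \<open>h\<close> to \<open>h'\<close> lowers the variance by
      \<open>(inner h (C k))\<^sup>2\<close>, exactly what the resampled coordinate
      restores.\<close>
    define h' where "h' = h - inner h (C k) *\<^sub>R k"
    have "inner h' (C h') = inner h (C h) - (inner h (C k))\<^sup>2"
      using k sa[of k h] sa[of h k]
      by (simp add: h'_def C.diff C.scaleR inner_simps power2_eq_square inner_commute algebra_simps)
    then have split: "exp (- (inner h (C h)) / 2)
        = exp (- (inner h' (C h')) / 2) * exp (- (inner h (C k))\<^sup>2 / 2)"
      by (simp add: exp_add[symmetric] diff_divide_distrib)
    have "(\<integral>z. iexp (inner h z) \<partial>distr ?P borel ?f) = (\<integral>z. iexp (inner h (?f z)) \<partial>?P)"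
      by (rule integral_distr) measurable
    also have "\<dots> = (\<integral>z. (\<lambda>(x, s). iexp (inner h' x) * iexp (inner h (C k) * s)) z \<partial>?P)"
      by (intro Bochner_Integration.integral_cong)
        (auto simp: h'_def exp_add[symmetric] inner_simps inner_commute algebra_simps split: prod.split)
    also have "\<dots> = (\<integral>x. \<integral>s. iexp (inner h' x) * iexp (inner h (C k) * s) \<partial>std_normal_distribution \<partial>M)"
      by (subst PP.integral_fst'[symmetric])
        (auto intro!: PP.integrable_const_bound[where B=1] simp: norm_mult split: prod.split)
    also have "\<dots> = (\<integral>x. iexp (inner h' x) \<partial>M) * char std_normal_distribution (inner h (C k))"
      by (simp add: char_def)
    also have "\<dots> = complex_of_real (exp (- (inner h (C h)) / 2))"
      unfolding gaussian_measure_fourier[OF gauss nonneg] char_std_normal_distribution split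
      by simp
    finally show "(\<integral>x. iexp (inner h x) \<partial>M) = (\<integral>z. iexp (inner h z) \<partial>distr ?P borel ?f)"
      using gaussian_measure_fourier[OF gauss nonneg, of h] by simp
  qed (auto simp: setsM intro!: finite_measure_axioms prob_space.finite_measure PP.prob_space_distr)
qed

text \<open>By resampling, a set is null iff almost every line in direction \<open>C k\<close> meets
  it in a null set for the normal law, equivalently for Lebesgue measure, as the density is
  positive. Lebesgue null sets are translation invariant.\<close>

lemma gaussian_measure_null_shift:
  fixes C :: "'h::{real_inner,complete_space,second_countable_topology} \<Rightarrow> 'h"
  assumes gauss: "gaussian_measure M C"
    and lin: "bounded_linear C"
    and sa: "\<And>x z. inner (C x) z = inner x (C z)"
    and nonneg: "\<And>x. 0 \<le> inner x (C x)"
    and k: "inner k (C k) = 1"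
    and A[measurable]: "A \<in> sets borel" and null: "AE x in M. x \<notin> A"
  shows "AE x in M. x + t *\<^sub>R C k \<notin> A"
proof -
  from gauss have "prob_space M" and [measurable_cong]: "sets M = sets borel"
    by (simp_all add: gaussian_measure_def)
  interpret prob_space M by fact
  interpret N: prob_space std_normal_distribution
    by (rule prob_space_normal_density) simp
  interpret PP: pair_prob_space M std_normal_distribution ..
  have resample: "(AE x in M. x \<notin> B) \<longleftrightarrow>
      (AE x in M. AE s in lborel. x - inner k x *\<^sub>R C k + s *\<^sub>R C k \<notin> B)"
    if [measurable]: "B \<in> sets borel" for B
  proof -
    let ?P = "M \<Otimes>\<^sub>M std_normal_distribution"
    have [measurable]: "(\<lambda>z. fst z - inner k (fst z) *\<^sub>R C k + snd z *\<^sub>R C k) \<in> borel_measurable ?P"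
      by measurable
    have "(AE x in M. x \<notin> B) \<longleftrightarrow>
        (AE z in ?P. fst z - inner k (fst z) *\<^sub>R C k + snd z *\<^sub>R C k \<notin> B)"
      by (subst gaussian_measure_resample[OF gauss lin sa nonneg k], subst AE_distr_iff)
        (auto simp: case_prod_beta)
    also have "\<dots> \<longleftrightarrow> (AE x in M. AE s in std_normal_distribution.
        x - inner k x *\<^sub>R C k + s *\<^sub>R C k \<notin> B)"
      by (rule PP.AE_pair_iff[symmetric]) measurable
    also have "\<dots> \<longleftrightarrow> (AE x in M. AE s in lborel. x - inner k x *\<^sub>R C k + s *\<^sub>R C k \<notin> B)"
      by (simp add: AE_density normal_density_pos)
    finally show ?thesis .
  qed
  have shift: "AE s in lborel. s + t \<notin> D" if "AE s in lborel. s \<notin> D" "D \<in> sets borel" for D :: "real set"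
  proof -
    have "AE s in distr lborel borel ((+) t). s \<notin> D"
      using that(1) by (subst lborel_distr_plus)
    then show ?thesis
      using that(2) by (subst (asm) AE_distr_iff) (auto simp: add.commute)
  qed
  have meas: "{x. x + t *\<^sub>R C k \<in> A} \<in> sets borel" by measurable
  have "AE x in M. AE s in lborel. x - inner k x *\<^sub>R C k + (s + t) *\<^sub>R C k \<notin> A"
    using null[unfolded resample[OF A]]
  proof eventually_elim
    case (elim x)
    then show ?case
      using shift[of "{s. x - inner k x *\<^sub>R C k + s *\<^sub>R C k \<in> A}"] by simp
  qed
  then show ?thesis
    using resample[OF meas] by (simp add: algebra_simps)
qed

text \<open>Shift invariance makes all translates of a null set by the span of the
  \<open>C (k i)\<close> null, and Fubini exchanges the point with the translation parameter. The
  map \<open>b\<close> selects a base point on each fibre.\<close>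

lemma gaussian_measure_null_iff_fibres:
  fixes C :: "'h::{real_inner,complete_space,second_countable_topology} \<Rightarrow> 'h"
    and k :: "'r::finite \<Rightarrow> 'h"
  assumes gauss: "gaussian_measure M C"
    and lin: "bounded_linear C"
    and sa: "\<And>x z. inner (C x) z = inner x (C z)"
    and nonneg: "\<And>x. 0 \<le> inner x (C x)"
    and k: "\<And>i. inner (k i) (C (k i)) = 1"
    and A[measurable]: "A \<in> sets borel"
    and b[measurable]: "b \<in> borel_measurable borel"
    and b: "\<And>x. \<exists>c. b x = x + (\<Sum>i\<in>UNIV. (c $ i) *\<^sub>R C (k i))"
  shows "(AE x in M. x \<notin> A) \<longleftrightarrow>
    (AE x in M. AE a in lborel. b x + (\<Sum>i\<in>UNIV. ((a :: real^'r) $ i) *\<^sub>R C (k i)) \<notin> A)"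
proof -
  from gauss have "prob_space M" and [measurable_cong]: "sets M = sets borel"
    by (simp_all add: gaussian_measure_def)
  interpret prob_space M by fact
  interpret pair_sigma_finite M "lborel :: (real^'r) measure" ..
  define X where "X a = (\<Sum>i\<in>UNIV. (a $ i) *\<^sub>R C (k i))" for a :: "real^'r"
  have X_meas[measurable]: "X \<in> borel_measurable borel"
    unfolding X_def by (intro borel_measurable_continuous_onI continuous_intros)
  have X_add: "X (a + c) = X a + X c" for a c
    by (simp add: X_def scaleR_add_left sum.distrib)
  have null_shift: "AE x in M. x + X a \<notin> B" if "B \<in> sets borel" "AE x in M. x \<notin> B" for a B
  proof -
    have "AE x in M. x + (\<Sum>i\<in>J. (a $ i) *\<^sub>R C (k i)) \<notin> B" if "finite J" for J
      using that
    proof (induction J)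
      case empty
      show ?case using \<open>AE x in M. x \<notin> B\<close> by simp
    next
      case (insert j J)
      have "{x. x + (\<Sum>i\<in>J. (a $ i) *\<^sub>R C (k i)) \<in> B} \<in> sets borel"
        using \<open>B \<in> sets borel\<close> by measurable
      from gaussian_measure_null_shift[OF gauss lin sa nonneg k[of j] this, of "a $ j"] insert
      show ?case by (simp add: algebra_simps)
    qed
    from this[of UNIV] show ?thesis by (simp add: X_def)
  qed
  have swap: "(AE x in M. AE a in lborel. x + X a \<notin> A) \<longleftrightarrow> (AE a in lborel. AE x in M. x + X a \<notin> A)"
    by (rule AE_commute) measurable
  have "(AE x in M. x \<notin> A) \<longleftrightarrow> (AE a in lborel. AE x in M. x + X a \<notin> A)"
  proof
    assume "AE x in M. x \<notin> A"
    then show "AE a in lborel. AE x in M. x + X a \<notin> A"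
      using null_shift[OF A] by simp
  next
    assume "AE a in lborel. AE x in M. x + X a \<notin> A"
    \<comment> \<open>Lebesgue measure is nonzero, so an almost-everywhere statement supplies at
      least one good \<open>a\<close>; translating by \<open>- a\<close> returns to
      \<open>A\<close>.\<close>
    moreover have "ae_filter (lborel :: (real^'r) measure) \<noteq> bot"
      by (simp add: ae_filter_eq_bot_iff)
    ultimately obtain a where a: "AE x in M. x + X a \<notin> A"
      using eventually_happens' by blast
    have "{x. x + X a \<in> A} \<in> sets borel" by measurable
    from null_shift[OF this, of "- a"] a show "AE x in M. x \<notin> A"
      using X_add[of "- a" a] by (simp add: X_def add.assoc)
  qed
  also have "\<dots> \<longleftrightarrow> (AE x in M. AE a in lborel. x + X a \<notin> A)" using swap by simp
  also have "\<dots> \<longleftrightarrow> (AE x in M. AE a in lborel. b x + X a \<notin> A)"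
  \<comment> \<open>For fixed \<open>x\<close>, moving the base point to \<open>b x\<close> merely
    translates the coefficient \<open>a\<close> by \<open>c\<close>.\<close>
  proof (rule AE_cong)
    fix x
    obtain c where c: "b x = x + X c" using b by (auto simp: X_def)
    have [measurable]: "{a. x + X a \<in> A} \<in> sets borel" by measurable
    have "(AE a in lborel. x + X a \<notin> A) \<longleftrightarrow> (AE a in distr lborel borel ((+) c). x + X a \<notin> A)"
      by (subst lborel_distr_plus) (rule refl)
    also have "\<dots> \<longleftrightarrow> (AE a in lborel. x + X (c + a) \<notin> A)"
      by (subst AE_distr_iff) auto
    finally show "(AE a in lborel. x + X a \<notin> A) = (AE a in lborel. b x + X a \<notin> A)"
      by (simp add: c X_add add.assoc)
  qed
  finally show ?thesis by (simp add: X_def)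
qed

section \<open>The RTO transport map\<close>

lemma diag_mat_mult_vec: "diag_mat d *v x = (\<chi> i. d $ i * x $ i)"
  by (simp add: diag_mat_def matrix_vector_mult_def vec_eq_iff if_distrib[of "\<lambda>z. z * _"] cong: if_cong)

section \<open>Lebesgue null sets under bi-Lipschitz maps\<close>

lemma negligible_lipschitz_image:
  fixes f :: "'a::euclidean_space \<Rightarrow> 'a"
  assumes "L-lipschitz_on UNIV f" "negligible S"
  shows "negligible (f ` S)"
proof (rule negligible_locally_Lipschitz_image[OF order_refl assms(2)])
  fix x
  have "norm (f z - f x) \<le> L * norm (z - x)" for z
    using lipschitz_onD[OF assms(1), of z x] by (simp add: dist_norm)
  then show "\<exists>T B. open T \<and> x \<in> T \<and> (\<forall>z\<in>S \<inter> T. norm (f z - f x) \<le> B * norm (z - x))"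
    by (intro exI[of _ UNIV] exI[of _ L]) simp
qed

lemma AE_lborel_iff_negligible:
  fixes S :: "'a::euclidean_space set"
  assumes "S \<in> sets borel"
  shows "(AE x in lborel. x \<notin> S) \<longleftrightarrow> negligible S"
  using assms AE_iff_null_sets[of S lborel]
  by (simp add: negligible_iff_null_sets null_sets_completion_iff)

lemma AE_lborel_bilipschitz:
  fixes f g :: "'a::euclidean_space \<Rightarrow> 'a"
  assumes f: "L-lipschitz_on UNIV f" and g: "K-lipschitz_on UNIV g"
    and fg: "\<And>x. f (g x) = x" and gf: "\<And>x. g (f x) = x"
    and S[measurable]: "S \<in> sets borel"
  shows "(AE x in lborel. f x \<notin> S) \<longleftrightarrow> (AE x in lborel. x \<notin> S)"
proof -
  have [measurable]: "f \<in> borel_measurable borel"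
    using lipschitz_on_continuous_on[OF f] by (rule borel_measurable_continuous_onI)
  have pre: "{x. f x \<in> S} = g ` S" and S_eq: "S = f ` {x. f x \<in> S}"
    by (auto simp: fg image_iff) (metis gf, metis fg)
  have "{x. f x \<in> S} \<in> sets borel" by measurable
  then have "(AE x in lborel. f x \<notin> S) \<longleftrightarrow> negligible {x. f x \<in> S}"
    using AE_lborel_iff_negligible[of "{x. f x \<in> S}"] by simp
  also have "\<dots> \<longleftrightarrow> negligible S"
    using negligible_lipschitz_image[OF f, of "{x. f x \<in> S}"] negligible_lipschitz_image[OF g, of S]
      pre S_eq by metis
  finally show ?thesis using AE_lborel_iff_negligible[OF S] by simp
qed

theorem theorem4p1:
  fixes Gpr Gh :: "'h::{real_inner,complete_space,second_countable_topology} \<Rightarrow> 'h"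
    and mu_pr :: "'h measure"
    and F :: "'h \<Rightarrow> real^'m" and F' :: "'h \<Rightarrow> ('h \<Rightarrow>\<^sub>L (real^'m))"
    and y :: "real^'m" and Gobs S :: "real^'m^'m"
    and v_ref :: 'h
    and Psi :: "real^'r^'m" and lam :: "real^'r" and phi :: "'r \<Rightarrow> 'h"
    and T :: "'h \<Rightarrow> 'h"
    and u_ref :: 'h and chi :: "'r \<Rightarrow> 'h" and X :: "real^'r \<Rightarrow> 'h"
    and R :: "'h \<Rightarrow> real^'r" and P :: "'h \<Rightarrow> 'h" and Wperp :: "'h set"
    and mu_RTO :: "'h measure"
  defines "u_ref \<equiv> Gh v_ref"
    and "chi \<equiv> \<lambda>i. Gh (phi i)"
    and "X \<equiv> \<lambda>a::real^'r. \<Sum>i\<in>UNIV. (a $ i) *\<^sub>R chi i"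
    and "R \<equiv> \<lambda>u. (\<chi> i. inner u (inv Gh (inv Gh (chi i))))"
    and "P \<equiv> \<lambda>u. \<Sum>i\<in>UNIV. (R u $ i) *\<^sub>R chi i"
    and "Wperp \<equiv> range (\<lambda>u. u - P u)"
    and "mu_RTO \<equiv> distr mu_pr borel T"
  assumes Gpr_lin: "bounded_linear Gpr"
    and Gpr_sa: "\<forall>x z. inner (Gpr x) z = inner x (Gpr z)"
    and Gpr_pd: "\<forall>x. x \<noteq> 0 \<longrightarrow> inner x (Gpr x) > 0"
    and Gpr_tr: "pos_trace_class Gpr"
    and Gh_lin: "bounded_linear Gh"
    and Gh_sa: "\<forall>x z. inner (Gh x) z = inner x (Gh z)"
    and Gh_pos: "\<forall>x. inner x (Gh x) \<ge> 0"
    and Gh_sq: "Gh \<circ> Gh = Gpr"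
    and prior: "gaussian_measure mu_pr Gpr"
    and F_deriv: "\<forall>x. (F has_derivative blinfun_apply (F' x)) (at x)"
    and F'_cont: "continuous_on UNIV F'"
    and Gobs_sym: "transpose Gobs = Gobs"
    and Gobs_pd: "\<forall>x. x \<noteq> 0 \<longrightarrow> inner x (Gobs *v x) > 0"
    and Gobs_S: "Gobs = S ** transpose S"
    and svd: "\<forall>h. matrix_inv S *v blinfun_apply (F' u_ref) (Gh h)
                  = Psi *v (diag_mat lam *v (\<chi> i. inner (phi i) h))"
    and Psi_on: "transpose Psi ** Psi = mat 1"
    and lam_pos: "\<forall>i. lam $ i > 0"
    and phi_on: "\<forall>i j. inner (phi i) (phi j) = (if i = j then 1 else 0)"
    and lip: "\<forall>b\<in>Wperp.
               (\<exists>L. L-lipschitz_on UNIV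
                  (\<lambda>a. a + diag_mat lam *v (transpose Psi *v (matrix_inv S *v F (X a + b))))) \<and>
               inj (\<lambda>a. a + diag_mat lam *v (transpose Psi *v (matrix_inv S *v F (X a + b)))) \<and>
               (\<exists>L. L-lipschitz_on
                  (range (\<lambda>a. a + diag_mat lam *v (transpose Psi *v (matrix_inv S *v F (X a + b)))))
                  (inv (\<lambda>a. a + diag_mat lam *v (transpose Psi *v (matrix_inv S *v F (X a + b))))))"
    and T_meas: "T \<in> borel_measurable borel"
    and T_sys: "\<forall>\<zeta>. \<zeta> - P \<zeta> = T \<zeta> - P (T \<zeta>) \<and>
               P \<zeta> = X (diag_mat (\<chi> i. 1 / sqrt ((lam $ i)\<^sup>2 + 1)) *v
                      (R (T \<zeta>) + diag_mat lam *v (transpose Psi *v (matrix_inv S *v (F (T \<zeta>) - y)))))"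
  shows "absolutely_continuous mu_pr mu_RTO \<and> absolutely_continuous mu_RTO mu_pr"
proof -

  \<comment> \<open>Coordinates on \<open>W\<close> and the projector\<close>
  interpret Gh: bounded_linear Gh by (rule Gh_lin)
  have Gpr_eq: "Gpr x = Gh (Gh x)" for x using Gh_sq by (metis comp_apply)
  have "inj Gh"
  proof (rule injI)
    fix x z assume "Gh x = Gh z"
    then have "Gpr (x - z) = 0" by (simp add: Gpr_eq Gh.diff)
    then show "x = z" using Gpr_pd[rule_format, of "x - z"] by auto
  qed
  define K where "K z = diag_mat lam *v (transpose Psi *v (matrix_inv S *v z))" for z
  have "\<exists>w. phi i = Gh w" for i
  proof -
    \<comment> \<open>Applied to \<open>Gh h\<close>, this functional returns
      \<open>inner (phi i) h\<close> by the SVD. Its Riesz vector \<open>w\<close> thus satisfies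
      \<open>Gh w = phi i\<close>, by self-adjointness of \<open>Gh\<close>.\<close>
    have bl: "bounded_linear (\<lambda>u. (transpose Psi *v (matrix_inv S *v blinfun_apply (F' u_ref) u)) $ i / lam $ i)"
      by (rule bounded_linear_compose[OF bounded_linear_divide]
          bounded_linear_compose[OF bounded_linear_vec_nth]
          bounded_linear_compose[OF matrix_vector_mul_bounded_linear] blinfun.bounded_linear_right)+
    obtain w where w: "\<And>u. (transpose Psi *v (matrix_inv S *v blinfun_apply (F' u_ref) u)) $ i / lam $ i = inner w u"
      using riesz_representation[OF bl] by blast
    have "inner (Gh w) h = inner (phi i) h" for h
    proof -
      have "transpose Psi *v (matrix_inv S *v blinfun_apply (F' u_ref) (Gh h))
          = diag_mat lam *v (\<chi> i. inner (phi i) h)"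
        by (metis svd matrix_vector_mul_assoc Psi_on matrix_vector_mul_lid)
      then show ?thesis
        using w[of "Gh h"] Gh_sa lam_pos[rule_format, of i] by (simp add: diag_mat_mult_vec)
    qed
    then have "inner (Gh w - phi i) (Gh w - phi i) = 0" by (simp add: inner_diff_left)
    then show ?thesis by (metis eq_iff_diff_eq_0 inner_eq_zero_iff)
  qed
  then obtain w where w: "\<And>i. phi i = Gh (w i)" by metis
  have chi_eq: "chi i = Gpr (w i)" for i by (simp add: chi_def w Gpr_eq)
  \<comment> \<open>Because \<open>chi i = Gh (Gh (w i))\<close>, both occurrences of
    \<open>inv Gh\<close> in \<open>R\<close> return true preimages, not default values.\<close>
  have R_eq: "R u $ i = inner u (w i)" for u i
    by (simp add: R_def chi_def w inv_f_f[OF \<open>inj Gh\<close>])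
  have ww: "inner (w i) (Gpr (w j)) = (if i = j then 1 else 0)" for i j
    using phi_on Gh_sa by (simp add: w Gpr_eq)
  have R_add: "R (u + v) = R u + R v" for u v
    by (simp add: vec_eq_iff R_eq inner_add_left)
  have R_X: "R (X a) = a" for a
  proof -
    have chi_w: "inner (chi j) (w i) = (if i = j then 1 else 0)" for i j
      using ww[of i j] by (simp add: chi_eq inner_commute)
    then show ?thesis
      by (simp add: vec_eq_iff R_eq X_def inner_sum_left chi_w if_distrib cong: if_cong)
  qed
  have P_eq: "P u = X (R u)" for u by (simp add: P_def X_def)
  have X_add: "X (a + c) = X a + X c" for a c
    by (simp add: X_def scaleR_add_left sum.distrib)
  have P_X: "P (X a) = X a" for a by (simp add: P_eq R_X)
  have P_add: "P (u + v) = P u + P v" for u v by (simp add: P_eq R_add X_add)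

  \<comment> \<open>Action of the transport map on the fibres\<close>
  define b where "b x = x - P x" for x
  have R_b: "R (b x) = 0" for x
    using R_add[of "b x" "P x"] by (simp add: b_def P_eq R_X)
  have P_b: "P (b x) = 0" for x by (simp add: P_eq R_b X_def)
  \<comment> \<open>The first equation of the system keeps the component in \<open>Wperp\<close>, so
    \<open>T\<close> only changes the coefficient in \<open>W\<close>.\<close>
  have T_fibre: "T (b x + X a) = b x + X (R (T (b x + X a)))" for x a
  proof -
    have "b x = T (b x + X a) - P (T (b x + X a))"
      using T_sys[rule_format, of "b x + X a"] by (simp add: P_add P_X P_b)
    then show ?thesis by (metis P_eq diff_add_cancel)
  qed
  have bilipschitz: "\<exists>f g L K. L-lipschitz_on UNIV f \<and> K-lipschitz_on UNIV g \<and>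
      (\<forall>a. f (g a) = a) \<and> (\<forall>a. g (f a) = a) \<and> (\<forall>a. T (b x + X a) = b x + X (f a))" for x
  proof -
    define G where "G a = a + K (F (X a + b x))" for a
    define D where "D = diag_mat (\<chi> i. 1 / sqrt ((lam $ i)\<^sup>2 + 1))"
    define E where "E = diag_mat (\<chi> i. sqrt ((lam $ i)\<^sup>2 + 1))"
    define f where "f a = R (T (b x + X a))" for a
    \<comment> \<open>This is the second equation solved for the coefficient of the prior draw,
      hence an explicit left inverse of \<open>f\<close>.\<close>
    define g where "g a = D *v (G a - K y)" for a
    have sq: "sqrt ((lam $ i)\<^sup>2 + 1) \<noteq> 0" for i
      using lam_pos by (metis add_nonneg_eq_0_iff real_sqrt_eq_zero_cancel_iff zero_le_one zero_le_power2 zero_neq_one)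
    have DE: "D *v (E *v a) = a" "E *v (D *v a) = a" for a
      using sq by (simp_all add: D_def E_def diag_mat_mult_vec vec_eq_iff)
    have "b x \<in> Wperp" by (auto simp: Wperp_def b_def)
    then obtain L L' where L: "L-lipschitz_on UNIV G" "inj G" "L'-lipschitz_on (range G) (inv G)"
      using lip unfolding G_def K_def by blast
    have g_f: "g (f a) = a" for a
    proof -
      have "X a = X (D *v (R (T (b x + X a)) + K (F (T (b x + X a)) - y)))"
        using T_sys[rule_format, of "b x + X a"] by (simp add: P_add P_X P_b D_def K_def)
      then have "a = D *v (R (T (b x + X a)) + K (F (T (b x + X a)) - y))" by (metis R_X)
      moreover have "F (T (b x + X a)) = F (X (f a) + b x)"
        using T_fibre[of x a] by (simp add: f_def add.commute)
      ultimately show ?thesis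
        by (simp add: g_def G_def f_def K_def matrix_vector_mult_diff_distrib algebra_simps)
    qed
    have G_f: "G (f a) = E *v a + K y" for a
      using arg_cong[OF g_f, of "(*v) E" a] by (simp add: g_def DE diff_eq_eq)
    \<comment> \<open>The system is solvable for every prior draw; the draw with coefficient
      \<open>D *v (z - K y)\<close> yields a preimage of \<open>z\<close>. The Lipschitz bound for
      \<open>inv G\<close> on \<open>range G\<close> then holds on the whole space.\<close>
    have "surj G"
    proof (rule surjI)
      show "G (f (D *v (z - K y))) = z" for z by (simp add: G_f DE)
    qed
    have f_eq: "f a = inv G (E *v a + K y)" for a
      using G_f[of a] inv_f_f[OF \<open>inj G\<close>] by metis
    have f_g: "f (g a) = a" for a
      by (simp add: f_eq g_def DE inv_f_f[OF \<open>inj G\<close>])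
    have mat: "\<exists>L. L-lipschitz_on UNIV ((*v) A)" for A :: "real^'r^'r"
      using bounded_linear.lipschitz_boundE[OF matrix_vector_mul_bounded_linear[of A]] by metis
    obtain LD where LD: "LD-lipschitz_on UNIV ((*v) D)" using mat by blast
    obtain LE where LE: "LE-lipschitz_on UNIV ((*v) E)" using mat by blast
    have "(L' * LE)-lipschitz_on UNIV f"
    proof (rule lipschitz_onI)
      fix a c
      have "dist (f a) (f c) \<le> L' * dist (E *v a) (E *v c)"
        using lipschitz_onD[OF L(3), of "E *v a + K y" "E *v c + K y"] \<open>surj G\<close>
        by (simp add: f_eq dist_norm)
      also have "\<dots> \<le> L' * (LE * dist a c)"
        by (intro mult_left_mono lipschitz_onD[OF LE] lipschitz_on_nonneg[OF L(3)]) simp_all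
      finally show "dist (f a) (f c) \<le> L' * LE * dist a c" by (simp add: mult.assoc)
    qed (simp add: lipschitz_on_nonneg[OF L(3)] lipschitz_on_nonneg[OF LE])
    moreover have "(LD * L)-lipschitz_on UNIV g"
    proof (rule lipschitz_onI)
      fix a c
      have "dist (g a) (g c) \<le> LD * dist (G a) (G c)"
        using lipschitz_onD[OF LD, of "G a - K y" "G c - K y"] by (simp add: g_def dist_norm)
      also have "\<dots> \<le> LD * (L * dist a c)"
        by (intro mult_left_mono lipschitz_onD[OF L(1)] lipschitz_on_nonneg[OF LD]) simp_all
      finally show "dist (g a) (g c) \<le> LD * L * dist a c" by (simp add: mult.assoc)
    qed (simp add: lipschitz_on_nonneg[OF L(1)] lipschitz_on_nonneg[OF LD])
    ultimately show ?thesis using f_g g_f T_fibre unfolding f_def by blast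
  qed

  \<comment> \<open>Transfer of null sets from fibres to the prior\<close>
  from prior have "prob_space mu_pr" and sets_mu[measurable_cong]: "sets mu_pr = sets borel"
    by (simp_all add: gaussian_measure_def)
  have Gpr_nonneg: "0 \<le> inner x (Gpr x)" for x
    using Gpr_pd[rule_format, of x] by (cases "x = 0") (auto simp: less_imp_le)
  have X_eq: "(\<Sum>i\<in>UNIV. (a $ i) *\<^sub>R Gpr (w i)) = X a" for a by (simp add: X_def chi_eq)
  have X_cont: "continuous_on UNIV X" unfolding X_def by (intro continuous_intros)
  have [measurable]: "X \<in> borel_measurable borel"
    using X_cont by (rule borel_measurable_continuous_onI)
  have b_meas: "b \<in> borel_measurable borel"
    unfolding b_def P_def R_eq by (intro borel_measurable_continuous_onI continuous_intros)
  have "\<exists>c. b x = x + X c" for x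
    using R_b X_add[of "R x" "- R x"] by (intro exI[of _ "- R x"]) (simp add: b_def P_eq X_def sum_negf)
  then have fibres: "(AE x in mu_pr. x \<notin> A) \<longleftrightarrow> (AE x in mu_pr. AE a in lborel. b x + X a \<notin> A)"
    if "A \<in> sets borel" for A
    \<comment> \<open>The vectors \<open>w i\<close> serve as the unit-variance functionals, with
      Cameron-Martin directions \<open>Gpr (w i) = chi i\<close>.\<close>
    using gaussian_measure_null_iff_fibres[OF prior Gpr_lin _ Gpr_nonneg _ that b_meas, of w] Gpr_sa ww
    by (simp add: X_eq)
  have null_iff: "(AE x in mu_pr. T x \<notin> A) \<longleftrightarrow> (AE x in mu_pr. x \<notin> A)"
    if A[measurable]: "A \<in> sets borel" for A
  proof -
    have "(AE a in lborel. T (b x + X a) \<notin> A) \<longleftrightarrow> (AE a in lborel. b x + X a \<notin> A)" for x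
    proof -
      obtain f g L K where fg: "L-lipschitz_on UNIV f" "K-lipschitz_on UNIV g" "\<And>a. f (g a) = a"
        "\<And>a. g (f a) = a" "\<And>a. T (b x + X a) = b x + X (f a)"
        using bilipschitz[of x] by metis
      have "{a. b x + X a \<in> A} \<in> sets borel" by measurable
      from AE_lborel_bilipschitz[OF fg(1-4) this] show ?thesis by (simp add: fg(5))
    qed
    moreover have "{x. T x \<in> A} \<in> sets borel" using T_meas by measurable
    ultimately show ?thesis using fibres[of "{x. T x \<in> A}"] fibres[OF A] by simp
  qed
  have "A \<in> null_sets mu_RTO \<longleftrightarrow> A \<in> null_sets mu_pr" if A[measurable]: "A \<in> sets borel" for A
  proof -
    have [measurable]: "T \<in> measurable mu_pr borel" using T_meas by measurable
    have "A \<in> null_sets mu_RTO \<longleftrightarrow> (AE x in mu_RTO. x \<notin> A)"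
      by (rule AE_iff_null_sets) (simp add: mu_RTO_def)
    also have "\<dots> \<longleftrightarrow> (AE x in mu_pr. T x \<notin> A)"
      unfolding mu_RTO_def by (rule AE_distr_iff) measurable
    finally show ?thesis using null_iff[OF A] AE_iff_null_sets[of A mu_pr] by (simp add: sets_mu)
  qed
  moreover have "sets mu_RTO = sets borel" by (simp add: mu_RTO_def)
  ultimately show ?thesis
    unfolding absolutely_continuous_def by (metis null_setsD2 sets_mu subsetI)
qed

end
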